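(* Assume that $\mathcal{X}$ is convex, that $F$ is $\mu$-strongly convex with $\mu>0$, that $G(\cdot,y)$ is linear for every $y\in\mathcal{Y}$ (so $G(x,y)=x^\top a(y)$), and that there exists $\hat{x}\in\mathcal{X}$ such that $\hat{x}^\top a(y)<0$ for all $y\in\mathcal{Y}$. Let $x^*$ be an optimal solution of the problem $\min\{F(x) : x\in\mathcal{X},\ x^\top z\le 0\ \forall z\in\mathcal{M}\}$, let $z^*$ be an optimal solution of the dual problem $\sup_{z\in\mathcal{K}}\theta(z)$, and let $\tau=\inf\{t\ge 0 : z^*\in t\,\mathsf{conv}(\mathcal{M})\}$ and $R=\sup_{z\in\mathcal{M}}\lVert z\rVert$. If the cutting-planes (CP) algorithm with a $\delta$-oracle, $\delta\in[0,1)$, and tolerance $\epsilon\ge 0$ executes iteration $k\in\mathbb{N}$, then $$F(x^* )-F(x^k)\le \frac{2R^2\tau^2}{\mu(1-\delta)^2}\,\frac{1}{k+2}.$$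
   Context: Setting. $m,n$ are positive integers, $F:\mathbb{R}^m\to\mathbb{R}$ and $G:\mathbb{R}^m\times\mathbb{R}^n\to\mathbb{R}$ are continuous, $\mathcal{X}\subset\mathbb{R}^m$ and $\mathcal{Y}\subset\mathbb{R}^n$ are non-empty and compact. The semi-infinite program (SIP) is $\min_{x\in\mathcal{X}}F(x)$ s.t. $G(x,y)\le 0$ for all $y\in\mathcal{Y}$, and $\phi(x)=\max_{y\in\mathcal{Y}}G(x,y)$. When $G(\cdot,y)$ is linear for each $y$, $a(y)\in\mathbb{R}^m$ is defined by $G(x,y)=x^\top a(y)$ (so $a$ is continuous), $\mathcal{M}=\{a(y):y\in\mathcal{Y}\}$ (compact), and $\mathcal{K}=\mathsf{cone}(\mathcal{M})$. Here $\mathsf{conv}$ denotes the convex hull and $\mathsf{cone}$ the generated convex cone (all finite nonnegative combinations; $\mathsf{conv}(\emptyset)=\emptyset$, $\mathsf{cone}(\emptyset)=\{0\}$). The norm is Euclidean and $\mathbb{N}=\{0,1,2,\dots\}$. The program (SIP) reads $\min_{x\in\mathcal{X}}F(x)$ s.t. $x^\top z\le 0$ for all $z\in\mathcal{M}$. Let $\mathcal{L}(x,z)=F(x)+x^\top z$ and $\theta(z)=\min_{x\in\mathcal{X}}\mathcal{L}(x,z)$; the dual problem is $\sup_{z\in\mathcal{K}}\theta(z)$, which admits an optimal solution under the assumptions of the claim. $\delta$-oracle ($\delta\in[0,1)$): for every $x\in\mathcal{X}$ it returns $\hat{y}(x)\in\mathcal{Y}$ and $\hat{v}(x)\ge\phi(x)$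 with $\hat{v}(x)-G(x,\hat{y}(x))\le\delta|\phi(x)|$. CP algorithm (input: a $\delta$-oracle, a tolerance $\epsilon\ge 0$). Start with $\mathcal{M}^0=\emptyset$. Iteration $k=0,1,2,\dots$ is: (1) compute an optimal solution $x^k$ of $\min_{x\in\mathcal{X}}F(x)$ s.t. $x^\top z\le 0$ for all $z\in\mathcal{M}^k$, and compute $z^k=\sum_{z\in\mathcal{M}^k}\lambda^k_z z$, where $\lambda^k_z\ge 0$ are Lagrange multipliers of these constraints, i.e. $z^k$ is an optimal solution of $\max_{z\in\mathsf{cone}(\mathcal{M}^k)}\theta(z)$ and the $\lambda_z^k$ are the coefficients of a decomposition of $z^k$ as a conic combination of elements of $\mathcal{M}^k$; (2) call the oracle at $x^k$ to get $y^k=\hat{y}(x^k)$ and set $\xi^k=a(y^k)\in\mathcal{M}$; (3) set $\mathcal{M}^{k+1}=\mathcal{B}^k\cup\{\xi^k\}$, where $\mathcal{B}^k$ is any finite subset of $\mathsf{conv}(\mathcal{M}^k)$ such that $z^k\in\mathsf{cone}(\mathcal{B}^k)$; (4) if $(\xi^k)^\top x^k\le\epsilon$ stop, otherwise proceed to iteration $k+1$. *)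

theory Defs
  imports "HOL-Analysis.Analysis"
begin

definition strongly_convex_on :: "(real^'m) set \<Rightarrow> real \<Rightarrow> (real^'m \<Rightarrow> real) \<Rightarrow> bool" where
  "strongly_convex_on S \<mu> f \<longleftrightarrow> convex S \<and>
     (\<forall>x\<in>S. \<forall>y\<in>S. \<forall>t\<in>{0..1}.
        f (t *\<^sub>R x + (1 - t) *\<^sub>R y)
          \<le> t * f x + (1 - t) * f y - \<mu> / 2 * t * (1 - t) * (norm (x - y))\<^sup>2)"

text \<open>The function \<open>\<phi>\<close>; the supremum is a maximum for nonempty compact \<open>Y\<close> and continuous \<open>G\<close>.\<close>

definition lower_value ::
  "(real^'n) set \<Rightarrow> (real^'m \<Rightarrow> real^'n \<Rightarrow> real) \<Rightarrow> real^'m \<Rightarrow> real" where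
  "lower_value Y G x = (SUP y\<in>Y. G x y)"

text \<open>The vector \<open>a(y)\<close>; it is meaningful when \<open>\<lambda>x. G x y\<close> is linear, see the lemma below.\<close>

definition coeff_vec :: "(real^'m \<Rightarrow> real^'n \<Rightarrow> real) \<Rightarrow> real^'n \<Rightarrow> real^'m" where
  "coeff_vec G y = (THE v. \<forall>x. G x y = x \<bullet> v)"

lemma coeff_vec_inner:
  assumes "linear (\<lambda>x. G x y)"
  shows "G x y = x \<bullet> coeff_vec G y"
proof -
  define w where "w = adjoint (\<lambda>x. G x y) 1"
  have w: "G x y = x \<bullet> w" for x
    using adjoint_works[OF assms, of x 1] by (simp add: w_def)
  have "coeff_vec G y = w"
    unfolding coeff_vec_def
  proof (rule the_equality)
    show "\<forall>x. G x y = x \<bullet> w" using w by blast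
  next
    fix v assume v: "\<forall>x. G x y = x \<bullet> v"
    have "x \<bullet> v = x \<bullet> w" for x
      using v w[of x] by simp
    then have "\<forall>x. x \<bullet> v = x \<bullet> w" by blast
    then show "v = w"
      using vector_eq_ldot[of v w] by blast
  qed
  with w[of x] show ?thesis by simp
qed

text \<open>\<open>N\<close> is the set of vectors \<open>z\<close> defining the constraints \<open>x \<bullet> z \<le> 0\<close>: all \<open>a(y)\<close>, \<open>y \<in> Y\<close>, for the
  full program, the current finite set for the master problems.\<close>

definition primal_optimal ::
  "(real^'m) set \<Rightarrow> (real^'m \<Rightarrow> real) \<Rightarrow> (real^'m) set \<Rightarrow> real^'m \<Rightarrow> bool" where
  "primal_optimal X F N x \<longleftrightarrow> is_arg_min F (\<lambda>x. x \<in> X \<and> (\<forall>z\<in>N. x \<bullet> z \<le> 0)) x"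

definition lagrangian :: "(real^'m \<Rightarrow> real) \<Rightarrow> real^'m \<Rightarrow> real^'m \<Rightarrow> real" where
  "lagrangian F x z = F x + x \<bullet> z"

definition dual_fun :: "(real^'m) set \<Rightarrow> (real^'m \<Rightarrow> real) \<Rightarrow> real^'m \<Rightarrow> real" where
  "dual_fun X F z = (INF x\<in>X. lagrangian F x z)"

text \<open>The generated convex cone is \<open>convex_cone hull\<close>, for which \<open>convex_cone hull {} = {0}\<close>;
  the library's \<open>cone hull\<close> is not convex in general and satisfies \<open>cone hull {} = {}\<close>.\<close>

definition dual_optimal ::
  "(real^'m) set \<Rightarrow> (real^'m \<Rightarrow> real) \<Rightarrow> (real^'m) set \<Rightarrow> real^'m \<Rightarrow> bool" where
  "dual_optimal X F N z \<longleftrightarrow> is_arg_max (dual_fun X F) (\<lambda>z. z \<in> convex_cone hull N) z"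

definition delta_oracle ::
  "(real^'m) set \<Rightarrow> (real^'n) set \<Rightarrow> (real^'m \<Rightarrow> real^'n \<Rightarrow> real) \<Rightarrow> real
    \<Rightarrow> (real^'m \<Rightarrow> real^'n) \<Rightarrow> (real^'m \<Rightarrow> real) \<Rightarrow> bool" where
  "delta_oracle X Y G \<delta> yhat vhat \<longleftrightarrow>
     (\<forall>x\<in>X. yhat x \<in> Y \<and> lower_value Y G x \<le> vhat x \<and>
            vhat x - G x (yhat x) \<le> \<delta> * \<bar>lower_value Y G x\<bar>)"

text \<open>One iteration, from the constraint set \<open>M\<close> to the constraint set \<open>M'\<close>: \<open>x\<close> is the primal
  iterate, \<open>z\<close> the dual iterate with multipliers \<open>l\<close>, \<open>\<xi>\<close> the new cut and \<open>B\<close> the set of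
  retained cuts.\<close>

definition cp_iteration ::
  "(real^'m) set \<Rightarrow> (real^'m \<Rightarrow> real) \<Rightarrow> (real^'m \<Rightarrow> real^'n \<Rightarrow> real) \<Rightarrow> (real^'m \<Rightarrow> real^'n)
    \<Rightarrow> (real^'m) set \<Rightarrow> real^'m \<Rightarrow> real^'m \<Rightarrow> (real^'m \<Rightarrow> real) \<Rightarrow> real^'m
    \<Rightarrow> (real^'m) set \<Rightarrow> (real^'m) set \<Rightarrow> bool" where
  "cp_iteration X F G yhat M x z l \<xi> B M' \<longleftrightarrow>
     primal_optimal X F M x \<and>
     dual_optimal X F M z \<and>
     (\<forall>v\<in>M. 0 \<le> l v) \<and> z = (\<Sum>v\<in>M. l v *\<^sub>R v) \<and>
     \<xi> = coeff_vec G (yhat x) \<and>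
     finite B \<and> B \<subseteq> convex hull M \<and> z \<in> convex_cone hull B \<and>
     M' = B \<union> {\<xi>}"

text \<open>The algorithm executes iteration \<open>k\<close>: iterations \<open>0, \<dots>, k\<close> are carried out, and the stopping
  test fails in each of the iterations \<open>0, \<dots>, k - 1\<close>. The values of the sequences beyond
  iteration \<open>k\<close> are irrelevant.\<close>

definition cp_executes ::
  "(real^'m) set \<Rightarrow> (real^'m \<Rightarrow> real) \<Rightarrow> (real^'m \<Rightarrow> real^'n \<Rightarrow> real) \<Rightarrow> (real^'m \<Rightarrow> real^'n)
    \<Rightarrow> real \<Rightarrow> nat
    \<Rightarrow> (nat \<Rightarrow> (real^'m) set) \<Rightarrow> (nat \<Rightarrow> real^'m) \<Rightarrow> (nat \<Rightarrow> real^'m)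
    \<Rightarrow> (nat \<Rightarrow> real^'m \<Rightarrow> real) \<Rightarrow> (nat \<Rightarrow> real^'m) \<Rightarrow> (nat \<Rightarrow> (real^'m) set) \<Rightarrow> bool" where
  "cp_executes X F G yhat \<epsilon> k M x z l \<xi> B \<longleftrightarrow>
     M 0 = {} \<and>
     (\<forall>j\<le>k. cp_iteration X F G yhat (M j) (x j) (z j) (l j) (\<xi> j) (B j) (M (Suc j))) \<and>
     (\<forall>j<k. \<not> \<xi> j \<bullet> x j \<le> \<epsilon>)"

end

theory Submission
  imports Defs
begin

text \<open>
  Seen from the dual, the cutting-planes algorithm is a fully corrective Frank-Wolfe method for
  maximising \<open>\<theta> = dual_fun X F\<close> over the convex cone generated by \<open>\<M>\<close>. The bound is the familiar
  \<open>1 / k\<close> rate of that method; it rests on three facts.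

  Strong convexity of \<open>F\<close> makes \<open>\<theta>\<close> smooth: if \<open>x\<close> minimises \<open>F x + x \<bullet> z\<close> over \<open>X\<close>, then
  \<open>\<theta> (z + d) \<ge> \<theta> z + x \<bullet> d - \<parallel>d\<parallel>\<^sup>2 / (2 * \<mu>)\<close>, so \<open>x\<close> acts as the gradient of \<open>\<theta>\<close> at \<open>z\<close>
  (\<open>dual_fun_quadratic_lower\<close>). Combined with the conic structure of the feasible set this also
  gives strong duality and complementary slackness for every pair of optimal solutions
  (\<open>optimal_pair_strong_duality\<close>), both for the full program and for each master problem.
  The gap \<open>h\<^sub>k = F x\<^sup>* - F x\<^sup>k\<close> is therefore the dual gap \<open>\<theta> z\<^sup>* - \<theta> z\<^sup>k\<close>.

  The gap is controlled by the oracle value. By weak duality at \<open>x\<^sup>k\<close>, \<open>h\<^sub>k \<le> x\<^sup>k \<bullet> z\<^sup>*\<close>, and \<open>z\<^sup>*\<close>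
  is \<open>\<tau>\<close> times a convex combination of elements of \<open>\<M>\<close>, so that \<open>h\<^sub>k \<le> \<tau> * \<phi> (x\<^sup>k)\<close> whenever
  \<open>\<phi> (x\<^sup>k) \<ge> 0\<close> (\<open>inner_le_gauge\<close>). The new cut \<open>\<xi>\<^sup>k\<close> has slope
  \<open>x\<^sup>k \<bullet> \<xi>\<^sup>k \<ge> (1 - \<delta>) * \<phi> (x\<^sup>k)\<close> and norm at most \<open>R\<close>.

  The next cone contains the whole ray \<open>z\<^sup>k + s * \<xi>\<^sup>k\<close>, \<open>s \<ge> 0\<close>, because the retained cuts still
  generate \<open>z\<^sup>k\<close>. The best step on this ray raises \<open>\<theta>\<close> by at least
  \<open>\<mu> * (x\<^sup>k \<bullet> \<xi>\<^sup>k)\<^sup>2 / (2 * R\<^sup>2)\<close> (\<open>dual_progress_along_ray\<close>). With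
  \<open>C = 2 * R\<^sup>2 * \<tau>\<^sup>2 / (\<mu> * (1 - \<delta>)\<^sup>2)\<close> these estimates combine to
  \<open>h\<^sub>k\<^sub>+\<^sub>1 \<le> h\<^sub>k - h\<^sub>k\<^sup>2 / C\<close> as long as \<open>h\<^sub>k > 0\<close>. The quadratic bound at \<open>z\<^sup>*\<close>, applied to the step back to \<open>z\<^sup>0 = 0\<close>,
  gives \<open>h\<^sub>0 \<le> C / 2\<close>, and \<open>h\<^sub>k \<le> C / (k + 2)\<close> follows by induction
  (\<open>quadratic_decrease_rate\<close>).
\<close>

section \<open>The dual function of a strongly convex program\<close>

lemma lagrangian_add: "lagrangian F x (z + d) = lagrangian F x z + x \<bullet> d"
  by (simp add: lagrangian_def inner_add_right)

lemma lagrangian_attains_min: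
  assumes "compact X" "X \<noteq> {}" "continuous_on X F"
  obtains x where "x \<in> X" "\<And>x'. x' \<in> X \<Longrightarrow> lagrangian F x z \<le> lagrangian F x' z"
proof -
  have "continuous_on X (\<lambda>x. lagrangian F x z)"
    unfolding lagrangian_def using assms(3) by (intro continuous_intros)
  from continuous_attains_inf[OF assms(1,2) this] show ?thesis
    using that by blast
qed

lemma dual_fun_eq_lagrangian:
  assumes "x \<in> X" "\<And>x'. x' \<in> X \<Longrightarrow> lagrangian F x z \<le> lagrangian F x' z"
  shows "dual_fun X F z = lagrangian F x z"
  unfolding dual_fun_def using assms by (intro cInf_eq_minimum) auto

lemma dual_fun_le_lagrangian:
  assumes "compact X" "continuous_on X F" "x \<in> X"
  shows "dual_fun X F z \<le> lagrangian F x z"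
proof -
  obtain x0 where "x0 \<in> X" "\<And>x'. x' \<in> X \<Longrightarrow> lagrangian F x0 z \<le> lagrangian F x' z"
    using lagrangian_attains_min[of X F z] assms by blast
  with assms(3) show ?thesis
    by (simp add: dual_fun_eq_lagrangian)
qed

lemma strongly_convex_on_subset:
  assumes "strongly_convex_on T \<mu> F" "S \<subseteq> T" "convex S"
  shows "strongly_convex_on S \<mu> F"
  using assms unfolding strongly_convex_on_def by (meson subsetD)

text \<open>The linear term \<open>x \<bullet> z\<close> does not affect strong convexity. Comparing the minimiser \<open>x0\<close> with
  the points of the segment towards \<open>x\<close> and letting them tend to \<open>x0\<close> keeps the full quadratic
  term.\<close>

lemma lagrangian_quadratic_growth:
  assumes sc: "strongly_convex_on X \<mu> F"
    and x0: "x0 \<in> X" "\<And>x'. x' \<in> X \<Longrightarrow> lagrangian F x0 z \<le> lagrangian F x' z"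
    and x: "x \<in> X"
  shows "lagrangian F x0 z + \<mu> / 2 * (norm (x - x0))\<^sup>2 \<le> lagrangian F x z"
proof -
  have "s * (\<mu> / 2 * (norm (x - x0))\<^sup>2) \<le> lagrangian F x z - lagrangian F x0 z"
    if s: "0 < s" "s < 1" for s
  proof -
    define t where "t = 1 - s"
    have t: "0 < t" "t \<le> 1" "s = 1 - t"
      using s by (simp_all add: t_def)
    define p where "p = t *\<^sub>R x + (1 - t) *\<^sub>R x0"
    have "p \<in> X"
      using sc x x0(1) t unfolding p_def strongly_convex_on_def
      by (intro convexD) auto
    then have "lagrangian F x0 z \<le> F p + p \<bullet> z"
      using x0(2)[of p] by (simp add: lagrangian_def)
    also have "F p \<le> t * F x + (1 - t) * F x0 - \<mu> / 2 * t * (1 - t) * (norm (x - x0))\<^sup>2"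
      using sc x x0(1) t unfolding p_def strongly_convex_on_def by auto
    also have "p \<bullet> z = t * (x \<bullet> z) + (1 - t) * (x0 \<bullet> z)"
      by (simp add: p_def inner_add_left)
    finally have "t * (s * (\<mu> / 2 * (norm (x - x0))\<^sup>2))
        \<le> t * (lagrangian F x z - lagrangian F x0 z)"
      by (simp add: lagrangian_def t(3) algebra_simps)
    then show ?thesis
      using t(1) by simp
  qed
  from field_le_mult_one_interval[OF this] show ?thesis
    by simp
qed

text \<open>Moving from \<open>z\<close> to \<open>z + d\<close> changes the Lagrangian at \<open>x\<close> by \<open>x \<bullet> d\<close>. Replacing \<open>x\<close> by
  the minimiser \<open>x0\<close> costs at most \<open>\<parallel>x - x0\<parallel> * \<parallel>d\<parallel>\<close>, and quadratic growth absorbs this up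
  to \<open>\<parallel>d\<parallel>\<^sup>2 / (2 * \<mu>)\<close>.\<close>

lemma dual_fun_quadratic_lower:
  assumes "\<mu> > 0" and sc: "strongly_convex_on X \<mu> F"
    and x0: "x0 \<in> X" "\<And>x'. x' \<in> X \<Longrightarrow> lagrangian F x0 z \<le> lagrangian F x' z"
  shows "dual_fun X F z + x0 \<bullet> d - (norm d)\<^sup>2 / (2 * \<mu>) \<le> dual_fun X F (z + d)"
proof -
  have "lagrangian F x0 z + x0 \<bullet> d - (norm d)\<^sup>2 / (2 * \<mu>) \<le> lagrangian F x (z + d)"
    if "x \<in> X" for x
  proof -
    define r where "r = norm (x - x0)"
    have growth: "lagrangian F x0 z + \<mu> / 2 * r\<^sup>2 \<le> lagrangian F x z"
      unfolding r_def by (rule lagrangian_quadratic_growth[OF sc x0 that])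
    have "\<bar>(x - x0) \<bullet> d\<bar> \<le> r * norm d"
      unfolding r_def by (rule Cauchy_Schwarz_ineq2)
    then have "x0 \<bullet> d - r * norm d \<le> x \<bullet> d"
      by (simp add: inner_diff_left)
    moreover have "\<mu> / 2 * r\<^sup>2 - r * norm d + (norm d)\<^sup>2 / (2 * \<mu>) = (\<mu> * r - norm d)\<^sup>2 / (2 * \<mu>)"
      using \<open>\<mu> > 0\<close> by (simp add: field_simps power2_eq_square)
    then have "0 \<le> \<mu> / 2 * r\<^sup>2 - r * norm d + (norm d)\<^sup>2 / (2 * \<mu>)"
      using \<open>\<mu> > 0\<close> by simp
    ultimately show ?thesis
      using growth by (simp add: lagrangian_add)
  qed
  then have "lagrangian F x0 z + x0 \<bullet> d - (norm d)\<^sup>2 / (2 * \<mu>) \<le> dual_fun X F (z + d)"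
    unfolding dual_fun_def using x0(1) by (intro cINF_greatest) auto
  with dual_fun_eq_lagrangian[OF x0] show ?thesis
    by simp
qed

section \<open>Strong duality\<close>

text \<open>First-order optimality: an ascent direction would beat the quadratic error term for small
  steps.\<close>

lemma dual_no_ascent:
  assumes "\<mu> > 0" "strongly_convex_on X \<mu> F"
    and "x0 \<in> X" "\<And>x'. x' \<in> X \<Longrightarrow> lagrangian F x0 z \<le> lagrangian F x' z"
    and le: "\<And>s. 0 < s \<Longrightarrow> s \<le> 1 \<Longrightarrow> dual_fun X F (z + s *\<^sub>R d) \<le> dual_fun X F z"
  shows "x0 \<bullet> d \<le> 0"
proof (rule ccontr)
  define g c where "g = x0 \<bullet> d" and "c = (norm d)\<^sup>2 / (2 * \<mu>)"
  assume "\<not> x0 \<bullet> d \<le> 0"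
  then have "g > 0" by (simp add: g_def)
  have bound: "g \<le> s * c" if "0 < s" "s \<le> 1" for s
  proof -
    have "s * g - s * (s * c) \<le> 0"
      using dual_fun_quadratic_lower[OF assms(1-4), of "s *\<^sub>R d"] le[OF that]
      by (simp add: g_def c_def power_mult_distrib power2_eq_square[of s] mult.assoc)
    then have "s * g \<le> s * (s * c)" by simp
    with that(1) show ?thesis by simp
  qed
  have "g \<le> c" using bound[of 1] by simp
  with \<open>g > 0\<close> have "0 < g / (2 * c)" "g / (2 * c) \<le> 1"
    by (simp_all add: field_simps)
  from bound[OF this] \<open>g \<le> c\<close> \<open>g > 0\<close> show False by simp
qed

text \<open>Let \<open>x0\<close> minimise the Lagrangian at the dual optimum \<open>z\<close>. The directions \<open>v \<in> N\<close> and \<open>\<plusminus>z\<close> are all feasible in the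
  cone, so by first-order optimality \<open>x0\<close> satisfies the constraints and \<open>x0 \<bullet> z = 0\<close>; thus its
  objective value is the dual value. Quadratic growth makes the minimiser unique, which identifies
  \<open>x0\<close> with the given primal solution.\<close>

lemma optimal_pair_strong_duality:
  assumes \<mu>: "\<mu> > 0" and sc: "strongly_convex_on X \<mu> F"
    and X: "compact X" "continuous_on X F"
    and primal: "primal_optimal X F N x" and dual: "dual_optimal X F N z"
  shows "x \<in> X" "F x = dual_fun X F z" "x \<bullet> z = 0"
    and "\<And>x'. x' \<in> X \<Longrightarrow> lagrangian F x z \<le> lagrangian F x' z"
proof -
  have x: "x \<in> X" "\<And>v. v \<in> N \<Longrightarrow> x \<bullet> v \<le> 0"
    and xmin: "\<And>y. y \<in> X \<Longrightarrow> (\<forall>v\<in>N. y \<bullet> v \<le> 0) \<Longrightarrow> F x \<le> F y"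
    using primal unfolding primal_optimal_def is_arg_min_linorder by auto
  have z: "z \<in> convex_cone hull N"
    and zmax: "\<And>w. w \<in> convex_cone hull N \<Longrightarrow> dual_fun X F w \<le> dual_fun X F z"
    using dual unfolding dual_optimal_def is_arg_max_linorder by auto
  obtain x0 where x0: "x0 \<in> X" "\<And>x'. x' \<in> X \<Longrightarrow> lagrangian F x0 z \<le> lagrangian F x' z"
    using lagrangian_attains_min[of X F z] X x(1) by blast
  have ascent: "x0 \<bullet> d \<le> 0"
    if "\<And>s. 0 < s \<Longrightarrow> s \<le> 1 \<Longrightarrow> z + s *\<^sub>R d \<in> convex_cone hull N" for d
    by (rule dual_no_ascent[OF \<mu> sc x0]) (use that zmax in auto)
  have feas: "x0 \<bullet> v \<le> 0" if "v \<in> N" for v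
    using that z by (intro ascent convex_cone_hull_add convex_cone_hull_mul) (auto intro: hull_inc)
  have "x0 \<bullet> z \<le> 0"
    using z by (intro ascent convex_cone_hull_add convex_cone_hull_mul) auto
  moreover have "x0 \<bullet> (- z) \<le> 0"
  proof (rule ascent)
    fix s :: real assume "0 < s" "s \<le> 1"
    then have "(1 - s) *\<^sub>R z \<in> convex_cone hull N"
      using z by (intro convex_cone_hull_mul) auto
    then show "z + s *\<^sub>R (- z) \<in> convex_cone hull N"
      by (simp add: scaleR_left_diff_distrib)
  qed
  ultimately have slack: "x0 \<bullet> z = 0" by simp
  have "convex_cone hull N \<subseteq> {v. x \<bullet> v \<le> 0}"
    using x(2) by (intro hull_minimal convex_cone_halfspace_le) auto
  with z have "x \<bullet> z \<le> 0" by blast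
  then have "lagrangian F x z \<le> F x" by (simp add: lagrangian_def)
  also have "F x \<le> F x0" using xmin x0(1) feas by blast
  also have "F x0 = lagrangian F x0 z" by (simp add: lagrangian_def slack)
  finally have "lagrangian F x z \<le> lagrangian F x0 z" .
  with lagrangian_quadratic_growth[OF sc x0 x(1)] have "\<mu> / 2 * (norm (x - x0))\<^sup>2 \<le> 0"
    by simp
  with \<mu> have "x = x0"
    by (simp add: mult_le_0_iff)
  with x0 slack show "x \<in> X" "F x = dual_fun X F z" "x \<bullet> z = 0"
    and "\<And>x'. x' \<in> X \<Longrightarrow> lagrangian F x z \<le> lagrangian F x' z"
    by (auto simp: dual_fun_eq_lagrangian[OF x0] lagrangian_def)
qed

section \<open>Gauge of the convex hull\<close>

text \<open>A linear functional bounded by \<open>c \<ge> 0\<close> on \<open>N\<close> is bounded by \<open>t * c\<close> on \<open>t\<close> times its convex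
  hull; the bound passes to the infimum over \<open>t\<close>, whether or not the infimum is attained.\<close>

lemma inner_le_gauge:
  fixes N :: "'a::real_inner set"
  assumes "N \<noteq> {}" "z \<in> convex_cone hull N"
    and c: "0 \<le> c" "\<And>v. v \<in> N \<Longrightarrow> x \<bullet> v \<le> c"
  shows "x \<bullet> z \<le> Inf {t. 0 \<le> t \<and> z \<in> (\<lambda>v. t *\<^sub>R v) ` (convex hull N)} * c"
proof -
  let ?T = "{t. 0 \<le> t \<and> z \<in> (\<lambda>v. t *\<^sub>R v) ` (convex hull N)}"
  have T: "?T \<noteq> {}"
    using assms(1,2) by (auto simp: convex_cone_hull_convex_hull_nonempty)
  have hull: "convex hull N \<subseteq> {v. x \<bullet> v \<le> c}"
    using c(2) by (intro hull_minimal convex_halfspace_le) auto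
  have bound: "x \<bullet> z \<le> t * c" if "t \<in> ?T" for t
    using that hull by (auto intro!: mult_left_mono)
  show ?thesis
  proof (cases "c = 0")
    case True
    with T bound show ?thesis by auto
  next
    case False
    with c(1) have "c > 0" by simp
    then have "x \<bullet> z / c \<le> Inf ?T"
      using T bound by (intro cInf_greatest) (auto simp: field_simps)
    with \<open>c > 0\<close> show ?thesis by (simp add: field_simps)
  qed
qed

lemma norm_le_gauge:
  fixes N :: "'a::real_inner set"
  assumes "N \<noteq> {}" "z \<in> convex_cone hull N"
    and R: "\<And>v. v \<in> N \<Longrightarrow> norm v \<le> R"
  shows "norm z \<le> Inf {t. 0 \<le> t \<and> z \<in> (\<lambda>v. t *\<^sub>R v) ` (convex hull N)} * R"
    (is "_ \<le> ?\<tau> * R")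
proof -
  have "?\<tau> \<ge> 0"
    using assms(1,2) by (intro cInf_greatest) (auto simp: convex_cone_hull_convex_hull_nonempty)
  have "R \<ge> 0"
    using assms(1) R norm_ge_zero by (metis equals0I order_trans)
  have "z \<bullet> v \<le> norm z * R" if "v \<in> N" for v
    using norm_cauchy_schwarz[of z v] mult_left_mono[OF R[OF that] norm_ge_zero[of z]] by linarith
  then have "z \<bullet> z \<le> ?\<tau> * (norm z * R)"
    using assms(1,2) \<open>R \<ge> 0\<close> by (intro inner_le_gauge) auto
  then have "norm z * norm z \<le> norm z * (?\<tau> * R)"
    by (simp add: dot_square_norm power2_eq_square mult_ac)
  with \<open>?\<tau> \<ge> 0\<close> \<open>R \<ge> 0\<close> show ?thesis
    by (cases "norm z = 0") (auto simp: mult_le_cancel_left)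
qed

section \<open>Semi-infinite linear constraints\<close>

lemma continuous_on_section:
  assumes "continuous_on UNIV (\<lambda>(x, y). G x y)"
  shows "continuous_on S (G x)"
proof -
  have "continuous_on S ((\<lambda>(x, y). G x y) \<circ> Pair x)"
    using assms by (intro continuous_on_compose continuous_intros) (auto intro: continuous_on_subset)
  then show ?thesis by (simp add: o_def)
qed

lemma compact_coeff_vec_image:
  fixes G :: "real^'m \<Rightarrow> real^'n \<Rightarrow> real"
  assumes "continuous_on UNIV (\<lambda>(x, y). G x y)" "compact Y"
    and "\<And>y. y \<in> Y \<Longrightarrow> linear (\<lambda>x. G x y)"
  shows "compact (coeff_vec G ` Y)"
proof -
  have "coeff_vec G y = (\<chi> i. G (axis i 1) y)" if "y \<in> Y" for y
    by (simp add: vec_eq_iff coeff_vec_inner[of G y, OF assms(3)[OF that]] inner_axis')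
  moreover have "continuous_on Y (\<lambda>y. \<chi> i. G (axis i 1) y)"
    by (intro continuous_on_vec_lambda continuous_on_section[OF assms(1)])
  ultimately have "continuous_on Y (coeff_vec G)"
    by (simp cong: continuous_on_cong)
  then show ?thesis
    using assms(2) by (rule compact_continuous_image)
qed

lemma inner_coeff_vec_le_lower_value:
  fixes G :: "real^'m \<Rightarrow> real^'n \<Rightarrow> real"
  assumes "continuous_on UNIV (\<lambda>(x, y). G x y)" "compact Y"
    and "\<And>y. y \<in> Y \<Longrightarrow> linear (\<lambda>x. G x y)" "y \<in> Y"
  shows "x \<bullet> coeff_vec G y \<le> lower_value Y G x"
proof -
  have "bdd_above (G x ` Y)"
    using assms(2) continuous_on_section[OF assms(1)]
    by (intro bounded_imp_bdd_above compact_imp_bounded compact_continuous_image)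
  then show ?thesis
    unfolding lower_value_def coeff_vec_inner[of G y, OF assms(3)[OF assms(4)], symmetric]
    using assms(4) by (intro cSUP_upper)
qed

text \<open>The oracle error is relative to \<open>\<bar>\<phi> x\<bar>\<close>, so at a point that violates some constraint the cut
  returned keeps the fraction \<open>1 - \<delta>\<close> of the largest violation.\<close>

lemma delta_oracle_cut:
  assumes orac: "delta_oracle X Y G \<delta> yhat vhat" and "x \<in> X"
    and lin: "\<And>y. y \<in> Y \<Longrightarrow> linear (\<lambda>x. G x y)" and "0 \<le> lower_value Y G x"
  shows "(1 - \<delta>) * lower_value Y G x \<le> x \<bullet> coeff_vec G (yhat x)"
proof -
  have "yhat x \<in> Y" "lower_value Y G x \<le> vhat x"
    "vhat x - G x (yhat x) \<le> \<delta> * \<bar>lower_value Y G x\<bar>"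
    using orac \<open>x \<in> X\<close> unfolding delta_oracle_def by auto
  with assms(4) show ?thesis
    by (simp add: coeff_vec_inner[of G "yhat x", OF lin] algebra_simps)
qed

section \<open>Progress and rate\<close>

text \<open>The step \<open>s = \<mu> * q / R\<^sup>2\<close> maximises the guaranteed increase \<open>s * q - s\<^sup>2 * R\<^sup>2 / (2 * \<mu>)\<close>.
  The product form of the conclusion also covers \<open>R = 0\<close>, where the cut is zero.\<close>

lemma dual_progress_along_ray:
  assumes \<mu>: "\<mu> > 0" and sc: "strongly_convex_on X \<mu> F"
    and x0: "x0 \<in> X" "\<And>x'. x' \<in> X \<Longrightarrow> lagrangian F x0 z \<le> lagrangian F x' z"
    and d: "norm d \<le> R" and q: "0 \<le> q" "q \<le> x0 \<bullet> d"
    and w: "\<And>s. 0 \<le> s \<Longrightarrow> dual_fun X F (z + s *\<^sub>R d) \<le> w"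
  shows "\<mu> * q\<^sup>2 \<le> 2 * R\<^sup>2 * (w - dual_fun X F z)"
proof (cases "R = 0")
  case True
  with d q have "q = 0" by auto
  with True show ?thesis by simp
next
  case False
  with d have "R > 0" using norm_ge_zero[of d] by linarith
  define s where "s = \<mu> * q / R\<^sup>2"
  have "s \<ge> 0" using \<mu> q by (simp add: s_def)
  have "s * q \<le> s * (x0 \<bullet> d)"
    using \<open>s \<ge> 0\<close> q(2) by (rule mult_left_mono[rotated])
  moreover have "s\<^sup>2 * (norm d)\<^sup>2 / (2 * \<mu>) \<le> s\<^sup>2 * R\<^sup>2 / (2 * \<mu>)"
    using d \<mu> by (intro divide_right_mono mult_left_mono power_mono) auto
  moreover have "dual_fun X F z + s * (x0 \<bullet> d) - s\<^sup>2 * (norm d)\<^sup>2 / (2 * \<mu>) \<le> w"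
    using dual_fun_quadratic_lower[OF \<mu> sc x0, of "s *\<^sub>R d"] w[OF \<open>s \<ge> 0\<close>]
    by (simp add: power_mult_distrib)
  ultimately have "s * q - s\<^sup>2 * R\<^sup>2 / (2 * \<mu>) \<le> w - dual_fun X F z"
    by linarith
  moreover have "s * q - s\<^sup>2 * R\<^sup>2 / (2 * \<mu>) = \<mu> * q\<^sup>2 / (2 * R\<^sup>2)"
    using \<mu> \<open>R > 0\<close> by (simp add: s_def field_simps power2_eq_square)
  ultimately show ?thesis
    using \<open>R > 0\<close> by (simp add: pos_divide_le_eq mult.commute)
qed

text \<open>For \<open>C > 0\<close> the map \<open>h \<mapsto> h - h\<^sup>2 / C\<close> is increasing on \<open>h \<le> C / 2\<close>, and at \<open>h = C / a\<close> it is
  at most \<open>C / (a + 1)\<close> because \<open>(a - 1) * (a + 1) \<le> a\<^sup>2\<close>. Stated as a product, the decrease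
  hypothesis forces \<open>C > 0\<close> as soon as some \<open>h j\<close> is positive, so \<open>C = 0\<close> is covered too.\<close>

lemma quadratic_decrease_rate:
  fixes h :: "nat \<Rightarrow> real"
  assumes C: "0 \<le> C" and h0: "h 0 \<le> C / 2"
    and mono: "\<And>j. j < k \<Longrightarrow> h (Suc j) \<le> h j"
    and dec: "\<And>j. j < k \<Longrightarrow> 0 < h j \<Longrightarrow> (h j)\<^sup>2 \<le> C * (h j - h (Suc j))"
  shows "h k \<le> C / (real k + 2)"
  using mono dec
proof (induction k)
  case 0
  with h0 show ?case by simp
next
  case (Suc k)
  then have IH: "h k \<le> C / (real k + 2)" by simp
  show ?case
  proof (cases "h k \<le> 0")
    case True
    with Suc.prems(1)[of k] have "h (Suc k) \<le> 0" by simp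
    also have "0 \<le> C / (real (Suc k) + 2)" using C by simp
    finally show ?thesis .
  next
    case False
    define a where "a = real k + 2"
    have a: "a \<ge> 2" by (simp add: a_def)
    have D: "(h k)\<^sup>2 \<le> C * (h k - h (Suc k))"
      using Suc.prems(2)[of k] False by simp
    then have "C > 0" using C False by (cases "C = 0") auto
    have le: "h k \<le> C / a" using IH by (simp add: a_def)
    have "C / a \<le> C / 2" using a \<open>C > 0\<close> by (intro divide_left_mono) auto
    then have "h k \<le> C - C / a" using le by linarith
    then have "0 \<le> (C / a - h k) * (C - C / a - h k)"
      using le by (intro mult_nonneg_nonneg) auto
    then have "C * h k - (h k)\<^sup>2 \<le> C * (C / a) - (C / a)\<^sup>2"
      by (simp add: algebra_simps power2_eq_square)
    also have "\<dots> = C * C * ((a - 1) / a\<^sup>2)"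
      using a by (simp add: field_simps power2_eq_square)
    also have "\<dots> \<le> C * C * (1 / (a + 1))"
      using a by (intro mult_left_mono) (auto simp: field_simps power2_eq_square)
    finally have "C * h (Suc k) \<le> C * (C / (a + 1))"
      using D by (simp add: algebra_simps)
    with \<open>C > 0\<close> have "h (Suc k) \<le> C / (a + 1)"
      by (simp only: mult_le_cancel_left_pos)
    then show ?thesis by (simp add: a_def add_ac)
  qed
qed

theorem theorem5:
  fixes F :: "real^'m \<Rightarrow> real"
    and G :: "real^'m \<Rightarrow> real^'n \<Rightarrow> real"
    and X :: "(real^'m) set" and Y :: "(real^'n) set"
    and \<mu> \<delta> \<epsilon> \<tau> R :: real
    and yhat :: "real^'m \<Rightarrow> real^'n" and vhat :: "real^'m \<Rightarrow> real"
    and xstar zstar :: "real^'m"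
    and k :: nat
    and Ms Bs :: "nat \<Rightarrow> (real^'m) set"
    and xs zs \<xi>s :: "nat \<Rightarrow> real^'m"
    and ls :: "nat \<Rightarrow> real^'m \<Rightarrow> real"
  defines "Mset \<equiv> coeff_vec G ` Y"
  defines "\<tau> \<equiv> Inf {t. 0 \<le> t \<and> zstar \<in> (\<lambda>v. t *\<^sub>R v) ` (convex hull Mset)}"
  defines "R \<equiv> (SUP z\<in>Mset. norm z)"
  assumes F_cont: "continuous_on UNIV F"
    and G_cont: "continuous_on UNIV (\<lambda>(x, y). G x y)"
    and X: "X \<noteq> {}" "compact X" "convex X"
    and Y: "Y \<noteq> {}" "compact Y"
    and \<mu>: "\<mu> > 0" "strongly_convex_on UNIV \<mu> F"
    and G_linear: "\<And>y. y \<in> Y \<Longrightarrow> linear (\<lambda>x. G x y)"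
    and slater: "\<exists>xhat\<in>X. \<forall>y\<in>Y. xhat \<bullet> coeff_vec G y < 0"
    and xstar: "primal_optimal X F Mset xstar"
    and zstar: "dual_optimal X F Mset zstar"
    and \<delta>: "0 \<le> \<delta>" "\<delta> < 1"
    and orac: "delta_oracle X Y G \<delta> yhat vhat"
    and \<epsilon>: "0 \<le> \<epsilon>"
    and run: "cp_executes X F G yhat \<epsilon> k Ms xs zs ls \<xi>s Bs"
  shows "F xstar - F (xs k) \<le> 2 * R\<^sup>2 * \<tau>\<^sup>2 / (\<mu> * (1 - \<delta>)\<^sup>2) * (1 / (real k + 2))"
proof -
  let ?\<phi> = "lower_value Y G"
  let ?\<theta> = "dual_fun X F"
  define C where "C = 2 * R\<^sup>2 * \<tau>\<^sup>2 / (\<mu> * (1 - \<delta>)\<^sup>2)"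
  define h where "h j = F xstar - F (xs j)" for j
  have sc: "strongly_convex_on X \<mu> F"
    using strongly_convex_on_subset[OF \<mu>(2) _ X(3)] by simp
  have F: "continuous_on X F"
    using F_cont by (rule continuous_on_subset) simp
  have compact: "compact Mset"
    unfolding Mset_def by (rule compact_coeff_vec_image[OF G_cont Y(2) G_linear])
  have "Mset \<noteq> {}" using Y(1) by (simp add: Mset_def)
  have zcone: "zstar \<in> convex_cone hull Mset"
    using zstar by (simp add: dual_optimal_def is_arg_max_def)
  have R: "norm v \<le> R" if "v \<in> Mset" for v
  proof -
    have "compact (norm ` Mset)"
      using compact by (intro compact_continuous_image continuous_intros)
    then have "bdd_above (norm ` Mset)"
      by (intro bounded_imp_bdd_above compact_imp_bounded)
    with that show ?thesis
      unfolding R_def by (intro cSUP_upper)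
  qed
  note star = optimal_pair_strong_duality[OF \<mu>(1) sc X(2) F xstar zstar]
  have iter: "cp_iteration X F G yhat (Ms j) (xs j) (zs j) (ls j) (\<xi>s j) (Bs j) (Ms (Suc j))"
    if "j \<le> k" for j
    using run that by (simp add: cp_executes_def)
  have opt: "primal_optimal X F (Ms j) (xs j)" "dual_optimal X F (Ms j) (zs j)" if "j \<le> k" for j
    using iter[OF that] unfolding cp_iteration_def by blast+
  note master = optimal_pair_strong_duality[OF \<mu>(1) sc X(2) F opt]
  have h_dual: "h j = ?\<theta> zstar - ?\<theta> (zs j)" if "j \<le> k" for j
    using star(2) master(2)[OF that] that by (simp add: h_def)

  have "0 \<le> C" using \<mu>(1) by (simp add: C_def)

  \<comment> \<open>The first master problem has no cuts, so its dual solution is \<open>0\<close>; \<open>xstar\<close> is the gradient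
    of the dual function at \<open>zstar\<close> and is orthogonal to the step from \<open>zstar\<close> to \<open>0\<close>.\<close>
  have "h 0 \<le> C / 2"
  proof -
    have "zs 0 = 0"
      using opt(2)[of 0] run by (simp add: dual_optimal_def is_arg_max_def cp_executes_def)
    then have "h 0 = ?\<theta> zstar - ?\<theta> (zstar + - zstar)"
      using h_dual[of 0] by simp
    also have "\<dots> \<le> (norm zstar)\<^sup>2 / (2 * \<mu>)"
      using dual_fun_quadratic_lower[OF \<mu>(1) sc star(1,4), of "- zstar"] star(3) by simp
    also have "\<dots> \<le> (\<tau> * R)\<^sup>2 / (2 * \<mu>)"
      using norm_le_gauge[OF \<open>Mset \<noteq> {}\<close> zcone R] \<mu>(1)
      by (intro divide_right_mono power_mono) (auto simp: \<tau>_def)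
    also have "\<dots> \<le> (\<tau> * R)\<^sup>2 / (\<mu> * (1 - \<delta>)\<^sup>2)"
    proof (intro divide_left_mono)
      have "(1 - \<delta>)\<^sup>2 \<le> 1" using \<delta> by (simp add: power_le_one)
      then have "\<mu> * (1 - \<delta>)\<^sup>2 \<le> \<mu> * 2" using \<mu>(1) by (intro mult_left_mono) auto
      then show "\<mu> * (1 - \<delta>)\<^sup>2 \<le> 2 * \<mu>" by simp
    qed (use \<mu>(1) \<delta> in auto)
    also have "\<dots> = C / 2" by (simp add: C_def power_mult_distrib mult_ac)
    finally show ?thesis .
  qed

  moreover have ray: "?\<theta> (zs j + s *\<^sub>R \<xi>s j) \<le> ?\<theta> (zs (Suc j))" if "j < k" "0 \<le> s" for j s
  proof -
    have "zs j \<in> convex_cone hull (Bs j)" and M': "Ms (Suc j) = Bs j \<union> {\<xi>s j}"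
      using iter[of j] that unfolding cp_iteration_def by auto
    then have "zs j \<in> convex_cone hull (Ms (Suc j))"
      using hull_mono[of "Bs j" "Ms (Suc j)" convex_cone] by auto
    moreover have "\<xi>s j \<in> convex_cone hull (Ms (Suc j))"
      using M' by (simp add: hull_inc)
    ultimately have "zs j + s *\<^sub>R \<xi>s j \<in> convex_cone hull (Ms (Suc j))"
      using that by (intro convex_cone_hull_add convex_cone_hull_mul)
    then show ?thesis
      using opt(2)[of "Suc j"] that by (simp add: dual_optimal_def is_arg_max_linorder)
  qed

  moreover have "h (Suc j) \<le> h j" if "j < k" for j
    using ray[OF that, of 0] that by (simp add: h_dual)

  moreover have "(h j)\<^sup>2 \<le> C * (h j - h (Suc j))" if "j < k" "0 < h j" for j
  proof -
    have "j \<le> k" using that by simp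
    note m = master[OF this this]
    let ?q = "?\<phi> (xs j)"
    have le: "xs j \<bullet> v \<le> ?q" if "v \<in> Mset" for v
      using that inner_coeff_vec_le_lower_value[OF G_cont Y(2) G_linear]
      by (auto simp: Mset_def)
    have "F xstar \<le> lagrangian F (xs j) zstar"
      using dual_fun_le_lagrangian[OF X(2) F m(1)] star(2) by simp
    then have weak: "h j \<le> xs j \<bullet> zstar"
      by (simp add: h_def lagrangian_def)
    \<comment> \<open>The gauge bound needs a nonnegative slope; the positive gap then excludes \<open>?q \<le> 0\<close>.\<close>
    also have "\<dots> \<le> \<tau> * max 0 ?q"
      unfolding \<tau>_def using le
      by (intro inner_le_gauge[OF \<open>Mset \<noteq> {}\<close> zcone]) (auto simp: le_max_iff_disj)
    finally have gap: "h j \<le> \<tau> * max 0 ?q" .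
    with that(2) have "?q > 0"
      by (cases "?q > 0") auto
    with gap have gap: "h j \<le> \<tau> * ?q" by simp
    have \<xi>: "\<xi>s j = coeff_vec G (yhat (xs j))"
      using iter[of j] that by (simp add: cp_iteration_def)
    then have "\<xi>s j \<in> Mset"
      using orac m(1) by (auto simp: Mset_def delta_oracle_def)
    have "(1 - \<delta>) * ?q \<le> xs j \<bullet> \<xi>s j"
      unfolding \<xi> using \<open>?q > 0\<close>
      by (intro delta_oracle_cut[OF orac m(1) G_linear]) auto
    then have "\<mu> * ((1 - \<delta>) * ?q)\<^sup>2 \<le> 2 * R\<^sup>2 * (?\<theta> (zs (Suc j)) - ?\<theta> (zs j))"
      using \<open>?q > 0\<close> \<delta> ray[OF that(1)]
      by (intro dual_progress_along_ray[OF \<mu>(1) sc m(1,4) R[OF \<open>\<xi>s j \<in> Mset\<close>]]) auto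
    also have "?\<theta> (zs (Suc j)) - ?\<theta> (zs j) = h j - h (Suc j)"
      using that by (simp add: h_dual)
    finally have prog: "\<mu> * ((1 - \<delta>) * ?q)\<^sup>2 \<le> 2 * R\<^sup>2 * (h j - h (Suc j))" .
    have "(h j)\<^sup>2 \<le> (\<tau> * ?q)\<^sup>2"
      using gap that(2) by (intro power_mono) auto
    also have "\<dots> = \<tau>\<^sup>2 / (\<mu> * (1 - \<delta>)\<^sup>2) * (\<mu> * ((1 - \<delta>) * ?q)\<^sup>2)"
      using \<mu>(1) \<delta>(2) by (simp add: power_mult_distrib)
    also have "\<dots> \<le> \<tau>\<^sup>2 / (\<mu> * (1 - \<delta>)\<^sup>2) * (2 * R\<^sup>2 * (h j - h (Suc j)))"
      using \<mu>(1) by (intro mult_left_mono[OF prog]) auto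
    also have "\<dots> = C * (h j - h (Suc j))"
      by (simp add: C_def mult_ac)
    finally show ?thesis .
  qed

  ultimately have "h k \<le> C / (real k + 2)"
    using \<open>0 \<le> C\<close> by (intro quadratic_decrease_rate)
  then show ?thesis
    by (simp add: h_def C_def)
qed

end
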